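(* Let $G$ be a countable group and let $A\subseteq G$. The following statements are equivalent: (i) $A$ is asymptotically scattered; (ii) $A$ is sparse, i.e. for every infinite subset $Y$ of $G$ there exists a finite subset $F\subset Y$ such that $\bigcap_{g\in F}gA$ is finite; (iii) for each free ultrafilter $\mathcal{U}$ on $G$ with $A\in\mathcal{U}$, the set $\{g\in G:A\in g\,\mathcal{U}\}$ is finite, where $g\,\mathcal{U}=\{gU:U\in\mathcal{U}\}$.
   Context: The group $G$ is considered with the ball structure whose radii are the finite subsets $F$ of $G$ and whose balls are $B(g,F)=Fg\cup\{g\}$ for $g\in G$. On a subset $A\subseteq G$ one takes the induced balls $B_A(a,F)=A\cap B(a,F)$, $a\in A$. A subset of $A$ is bounded if it is contained in some ball $B_A(a,F)$ (equivalently, apart from the trivial empty case, if it is finite). For radii $F,H$ write $F<H$ (relative to $A$) if $B_A(a,F)\subseteq B_A(a,H)$ for every $a\in A$. A subset $Y\subseteq A$ has asymptotically isolated balls in $A$ if there is a finite $F\subseteq G$ such that for every finite $H\subseteq G$ with $F<H$ there exists $y\in Y$ with $B_A(y,H)\setminus B_A(y,F)=\varnothing$. The subset $A$ is asymptotically scattered if each unbounded subset $Y\subseteq A$ has asymptotically isolated balls in $A$. *)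

theory Defs
  imports "HOL-Algebra.Coset" "HOL-Library.Countable_Set"
begin

definition radius :: "('a, 'b) monoid_scheme \<Rightarrow> 'a set \<Rightarrow> bool" where
  "radius G F \<longleftrightarrow> finite F \<and> F \<subseteq> carrier G"

definition group_ball :: "('a, 'b) monoid_scheme \<Rightarrow> 'a \<Rightarrow> 'a set \<Rightarrow> 'a set" where
  "group_ball G g F = (F #>\<^bsub>G\<^esub> g) \<union> {g}"

definition induced_ball :: "('a, 'b) monoid_scheme \<Rightarrow> 'a set \<Rightarrow> 'a \<Rightarrow> 'a set \<Rightarrow> 'a set" where
  "induced_ball G A a F = A \<inter> group_ball G a F"

(* The empty set counts as bounded even when A is empty and there is no ball to contain it. *)
definition bounded_subset :: "('a, 'b) monoid_scheme \<Rightarrow> 'a set \<Rightarrow> 'a set \<Rightarrow> bool" where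
  "bounded_subset G A Y \<longleftrightarrow>
     Y = {} \<or> (\<exists>a\<in>A. \<exists>F. radius G F \<and> Y \<subseteq> induced_ball G A a F)"

(* The relation F < H on radii relative to A; as usual for ball structures it is not strict. *)
definition radius_less :: "('a, 'b) monoid_scheme \<Rightarrow> 'a set \<Rightarrow> 'a set \<Rightarrow> 'a set \<Rightarrow> bool" where
  "radius_less G A F H \<longleftrightarrow> (\<forall>a\<in>A. induced_ball G A a F \<subseteq> induced_ball G A a H)"

definition has_asymptotically_isolated_balls ::
    "('a, 'b) monoid_scheme \<Rightarrow> 'a set \<Rightarrow> 'a set \<Rightarrow> bool" where
  "has_asymptotically_isolated_balls G A Y \<longleftrightarrow>
     (\<exists>F. radius G F \<and>
       (\<forall>H. radius G H \<and> radius_less G A F H \<longrightarrow>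
         (\<exists>y\<in>Y. induced_ball G A y H - induced_ball G A y F = {})))"

definition asymptotically_scattered :: "('a, 'b) monoid_scheme \<Rightarrow> 'a set \<Rightarrow> bool" where
  "asymptotically_scattered G A \<longleftrightarrow>
     (\<forall>Y. Y \<subseteq> A \<and> \<not> bounded_subset G A Y \<longrightarrow> has_asymptotically_isolated_balls G A Y)"

(* The intersection is taken inside G, so that for F = {} it is the whole group. *)
definition sparse_subset :: "('a, 'b) monoid_scheme \<Rightarrow> 'a set \<Rightarrow> bool" where
  "sparse_subset G A \<longleftrightarrow>
     (\<forall>Y. Y \<subseteq> carrier G \<and> infinite Y \<longrightarrow>
       (\<exists>F. finite F \<and> F \<subseteq> Y \<and> finite (carrier G \<inter> (\<Inter>g\<in>F. g <#\<^bsub>G\<^esub> A))))"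

definition ultrafilter_on :: "'a set \<Rightarrow> 'a set set \<Rightarrow> bool" where
  "ultrafilter_on X \<U> \<longleftrightarrow>
     \<U> \<subseteq> Pow X \<and> X \<in> \<U> \<and> {} \<notin> \<U> \<and>
     (\<forall>U\<in>\<U>. \<forall>V\<in>\<U>. U \<inter> V \<in> \<U>) \<and>
     (\<forall>U\<in>\<U>. \<forall>V. U \<subseteq> V \<and> V \<subseteq> X \<longrightarrow> V \<in> \<U>) \<and>
     (\<forall>U. U \<subseteq> X \<longrightarrow> U \<in> \<U> \<or> X - U \<in> \<U>)"

definition free_ultrafilter_on :: "'a set \<Rightarrow> 'a set set \<Rightarrow> bool" where
  "free_ultrafilter_on X \<U> \<longleftrightarrow> ultrafilter_on X \<U> \<and> \<Inter>\<U> = {}"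

definition translate_family :: "('a, 'b) monoid_scheme \<Rightarrow> 'a \<Rightarrow> 'a set set \<Rightarrow> 'a set set" where
  "translate_family G g \<U> = {g <#\<^bsub>G\<^esub> U | U. U \<in> \<U>}"

end

theory Submission
  imports Defs
begin

text \<open>
  If an infinite set \<open>Y \<subseteq> A\<close> has no asymptotically isolated balls, then for every finite \<open>F\<close>
  finitely many sets \<open>h\<inverse>A\<close> with \<open>h \<notin> F\<close> cover \<open>Y\<close>, so every free ultrafilter containing \<open>Y\<close>
  contains one of them; this contradicts (iii) when \<open>F\<close> is the set of all \<open>g\<close> with
  \<open>g\<inverse>A \<in> \<U>\<close>.  If \<open>A\<close> is not sparse, witnessed by distinct \<open>d\<^sub>0, d\<^sub>1, \<dots>\<close>, choose distinct \<open>x\<^sub>n\<close>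
  in \<open>d\<^sub>0A \<inter> \<dots> \<inter> d\<^sub>nA\<close> and put \<open>y\<^sub>n = d\<^sub>0\<inverse>x\<^sub>n \<in> A\<close>: every translation by \<open>d\<^sub>i\<inverse>d\<^sub>0\<close> maps almost all
  \<open>y\<^sub>n\<close> into \<open>A\<close>, so no ball around all but finitely many \<open>y\<^sub>n\<close> is isolated, and the remaining
  \<open>y\<^sub>n\<close> are dealt with one by one since \<open>A\<close> is infinite.
\<close>

section \<open>Ultrafilters: finite intersections and unions, and the existence of free ones\<close>

lemma ultrafilter_on_Int: "ultrafilter_on X \<U> \<Longrightarrow> U \<in> \<U> \<Longrightarrow> V \<in> \<U> \<Longrightarrow> U \<inter> V \<in> \<U>"
  unfolding ultrafilter_on_def by blast

lemma ultrafilter_on_compl: "ultrafilter_on X \<U> \<Longrightarrow> U \<subseteq> X \<Longrightarrow> U \<notin> \<U> \<Longrightarrow> X - U \<in> \<U>"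
  unfolding ultrafilter_on_def by blast

lemma ultrafilter_on_finite_Inter:
  assumes "ultrafilter_on X \<U>" "finite \<S>" "\<S> \<subseteq> \<U>"
  shows "X \<inter> \<Inter>\<S> \<in> \<U>"
  using assms(2,3)
proof (induction \<S> rule: finite_induct)
  case empty
  then show ?case using assms(1) by (simp add: ultrafilter_on_def)
next
  case (insert S \<S>)
  then have "S \<inter> (X \<inter> \<Inter>\<S>) \<in> \<U>"
    using ultrafilter_on_Int[OF assms(1)] by simp
  then show ?case by (simp add: Int_left_commute)
qed

lemma ultrafilter_on_finite_UN:
  assumes uf: "ultrafilter_on X \<U>" and "finite I" and B: "\<And>i. i \<in> I \<Longrightarrow> B i \<subseteq> X"
    and un: "(\<Union>i\<in>I. B i) \<in> \<U>"
  shows "\<exists>i\<in>I. B i \<in> \<U>"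
proof (rule ccontr)
  assume "\<not> ?thesis"
  then have "(\<lambda>i. X - B i) ` I \<subseteq> \<U>"
    using ultrafilter_on_compl[OF uf B] by blast
  then have "X \<inter> \<Inter>((\<lambda>i. X - B i) ` I) \<in> \<U>"
    using ultrafilter_on_finite_Inter[OF uf] \<open>finite I\<close> by blast
  then have "(\<Union>i\<in>I. B i) \<inter> (X \<inter> \<Inter>((\<lambda>i. X - B i) ` I)) \<in> \<U>"
    by (rule ultrafilter_on_Int[OF uf un])
  moreover have "(\<Union>i\<in>I. B i) \<inter> (X \<inter> \<Inter>((\<lambda>i. X - B i) ` I)) = {}" by auto
  ultimately show False using uf by (simp add: ultrafilter_on_def)
qed

text \<open>Freeness gives for each point a member missing it; intersecting a finite
  \<open>S\<close> with one such member per point of \<open>S\<close> would put the empty set into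
  the ultrafilter.\<close>

lemma free_ultrafilter_on_infinite:
  assumes free: "free_ultrafilter_on X \<U>" and S: "S \<in> \<U>"
  shows "infinite S"
proof
  assume "finite S"
  have uf: "ultrafilter_on X \<U>" using free by (simp add: free_ultrafilter_on_def)
  have "\<forall>x. \<exists>U\<in>\<U>. x \<notin> U" using free by (auto simp: free_ultrafilter_on_def)
  then obtain f where f: "\<And>x. f x \<in> \<U>" "\<And>x. x \<notin> f x" by metis
  have "X \<inter> \<Inter>(insert S (f ` S)) \<in> \<U>"
    using \<open>finite S\<close> f S by (intro ultrafilter_on_finite_Inter[OF uf]) auto
  moreover have "X \<inter> \<Inter>(insert S (f ` S)) = {}" using f(2) by auto
  ultimately show False using uf by (simp add: ultrafilter_on_def)
qed

text \<open>Zorn's lemma is applied to families containing \<open>Y\<close> whose finite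
  intersections are infinite. Asking for infinite rather than nonempty intersections makes a maximal
  family absorb all cofinite sets, so it is free.\<close>

lemma free_ultrafilter_on_exists:
  assumes "Y \<subseteq> X" "infinite Y"
  shows "\<exists>\<U>. free_ultrafilter_on X \<U> \<and> Y \<in> \<U>"
proof -
  define \<Z> where "\<Z> = {\<C>. Y \<in> \<C> \<and> \<C> \<subseteq> Pow X \<and>
    (\<forall>\<S>. finite \<S> \<and> \<S> \<subseteq> \<C> \<longrightarrow> infinite (X \<inter> \<Inter>\<S>))}"
  have "infinite X" using assms finite_subset by blast
  moreover have "X \<inter> Y = Y" using assms by blast
  ultimately have "{Y} \<in> \<Z>"
    using assms by (auto simp: \<Z>_def subset_singleton_iff)
  then have "\<Z> \<noteq> {}" by blast
  moreover have "\<Union>\<K> \<in> \<Z>" if \<K>: "\<K> \<noteq> {}" "subset.chain \<Z> \<K>" for \<K>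
  proof -
    have "infinite (X \<inter> \<Inter>\<S>)" if \<S>: "finite \<S>" "\<S> \<subseteq> \<Union>\<K>" for \<S>
    proof -
      obtain \<C> where "\<C> \<in> \<K>" "\<S> \<subseteq> \<C>"
        using finite_subset_Union_chain[OF \<S> \<K>] by blast
      then show ?thesis using \<K>(2) \<S>(1) by (auto simp: \<Z>_def subset.chain_def)
    qed
    then show ?thesis using \<K> by (auto simp: \<Z>_def subset.chain_def)
  qed
  ultimately obtain \<M> where "\<M> \<in> \<Z>" and max: "\<And>\<C>. \<C> \<in> \<Z> \<Longrightarrow> \<M> \<subseteq> \<C> \<Longrightarrow> \<C> = \<M>"
    using subset_Zorn_nonempty[of \<Z>] by metis
  then have Y: "Y \<in> \<M>" and sub: "\<M> \<subseteq> Pow X"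
    and inf: "\<And>\<S>. finite \<S> \<Longrightarrow> \<S> \<subseteq> \<M> \<Longrightarrow> infinite (X \<inter> \<Inter>\<S>)"
    by (auto simp: \<Z>_def)
  \<comment> \<open>By maximality \<open>V\<close> cannot be added, so some finite subfamily has
    only finitely many common points in \<open>V\<close>.\<close>
  have ext: "\<exists>\<S>. finite \<S> \<and> \<S> \<subseteq> \<M> \<and> finite (X \<inter> \<Inter>\<S> \<inter> V)" if V: "V \<subseteq> X" "V \<notin> \<M>" for V
  proof -
    have "insert V \<M> \<notin> \<Z>" using max V by blast
    then obtain \<S> where \<S>: "finite \<S>" "\<S> \<subseteq> insert V \<M>" "finite (X \<inter> \<Inter>\<S>)"
      using Y sub V by (auto simp: \<Z>_def)
    have "X \<inter> \<Inter>(\<S> - {V}) \<inter> V \<subseteq> X \<inter> \<Inter>\<S>" by auto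
    then have "finite (X \<inter> \<Inter>(\<S> - {V}) \<inter> V)" using \<S>(3) finite_subset by blast
    then show ?thesis using \<S> by (intro exI[of _ "\<S> - {V}"]) auto
  qed
  have compl: "V \<in> \<M> \<or> X - V \<in> \<M>" if V: "V \<subseteq> X" for V
  proof (rule ccontr)
    assume neg: "\<not> ?thesis"
    obtain \<S> where S: "finite \<S>" "\<S> \<subseteq> \<M>" "finite (X \<inter> \<Inter>\<S> \<inter> V)"
      using ext[of V] neg V by blast
    obtain \<T> where T: "finite \<T>" "\<T> \<subseteq> \<M>" "finite (X \<inter> \<Inter>\<T> \<inter> (X - V))"
      using ext[of "X - V"] neg by blast
    have "X \<inter> \<Inter>(\<S> \<union> \<T>) \<subseteq> (X \<inter> \<Inter>\<S> \<inter> V) \<union> (X \<inter> \<Inter>\<T> \<inter> (X - V))" by auto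
    then have "finite (X \<inter> \<Inter>(\<S> \<union> \<T>))"
      using S(3) T(3) finite_subset by blast
    then show False using inf[of "\<S> \<union> \<T>"] S T by blast
  qed
  \<comment> \<open>If \<open>V\<close> contains a finite intersection of members up to finitely
    many points, then \<open>X - V\<close> cannot be a member. Closure under intersections and
    supersets, \<open>X \<in> \<M>\<close> and freeness are all instances.\<close>
  have mem: "V \<in> \<M>" if "V \<subseteq> X" "finite \<S>" "\<S> \<subseteq> \<M>" "finite (X \<inter> \<Inter>\<S> - V)" for V \<S>
  proof (rule ccontr)
    assume "V \<notin> \<M>"
    then have "infinite (X \<inter> \<Inter>(insert (X - V) \<S>))"
      using compl[of V] that by (intro inf) auto
    moreover have "X \<inter> \<Inter>(insert (X - V) \<S>) = X \<inter> \<Inter>\<S> - V" by auto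
    ultimately show False using that by simp
  qed
  have "U \<inter> V \<in> \<M>" if "U \<in> \<M>" "V \<in> \<M>" for U V
  proof -
    have "X \<inter> \<Inter>{U, V} - U \<inter> V = {}" by auto
    then have "finite (X \<inter> \<Inter>{U, V} - U \<inter> V)" by (simp only: finite.emptyI)
    then show ?thesis using that sub by (intro mem[of "U \<inter> V" "{U, V}"]) auto
  qed
  moreover have "V \<in> \<M>" if "U \<in> \<M>" "U \<subseteq> V" "V \<subseteq> X" for U V
  proof -
    have "X \<inter> \<Inter>{U} - V = {}" using that by auto
    then have "finite (X \<inter> \<Inter>{U} - V)" by (simp only: finite.emptyI)
    then show ?thesis using that by (intro mem[of V "{U}"]) auto
  qed
  moreover have "{} \<notin> \<M>" using inf[of "{{}}"] by auto
  moreover have "X \<in> \<M>" using mem[of X "{}"] by simp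
  ultimately have "ultrafilter_on X \<M>"
    using sub compl by (auto simp: ultrafilter_on_def)
  moreover have "\<Inter>\<M> = {}"
  proof -
    have "X - {x} \<in> \<M>" for x
    proof (rule mem[of _ "{}"])
      have "X \<inter> \<Inter>{} - (X - {x}) \<subseteq> {x}" by auto
      then show "finite (X \<inter> \<Inter>{} - (X - {x}))" by (rule finite_subset) simp
    qed auto
    then show ?thesis by blast
  qed
  ultimately show ?thesis using Y by (auto simp: free_ultrafilter_on_def)
qed

section \<open>Distinct representatives for a sequence of infinite sets\<close>

lemma inj_choice_infinite:
  fixes S :: "nat \<Rightarrow> 'a set"
  assumes "\<And>n. infinite (S n)"
  shows "\<exists>x. inj x \<and> (\<forall>n. x n \<in> S n)"
proof -
  have "\<exists>x. \<forall>n. x n \<in> S n \<and> x n \<notin> x ` {..<n}"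
  proof (rule dependent_wellorder_choice)
    fix n and x :: "nat \<Rightarrow> 'a"
    have "infinite (S n - x ` {..<n})" using assms by (simp add: Diff_infinite_finite)
    then show "\<exists>r. r \<in> S n \<and> r \<notin> x ` {..<n}"
      using infinite_imp_nonempty by blast
  qed auto
  then obtain x where x: "\<And>n. x n \<in> S n" "\<And>n. x n \<notin> x ` {..<n}" by blast
  have "inj x"
    by (rule linorder_injI) (metis x(2) imageI lessThan_iff)
  then show ?thesis using x by blast
qed

section \<open>Translates and balls in a group\<close>

context group
begin

text \<open>Left translation by \<open>g\<close> is undone by \<open>inv g\<close>. This turns
  condition (iii) into a statement about which translates of \<open>A\<close> belong to
  \<open>\<U>\<close>.\<close>

lemma translate_family_iff:
  assumes A: "A \<subseteq> carrier G" and \<U>: "\<U> \<subseteq> Pow (carrier G)" and g: "g \<in> carrier G"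
  shows "A \<in> translate_family G g \<U> \<longleftrightarrow> inv g <# A \<in> \<U>"
proof
  assume "A \<in> translate_family G g \<U>"
  then obtain U where U: "U \<in> \<U>" "A = g <# U" by (auto simp: translate_family_def)
  then have "inv g <# A = U" using \<U> g by (subst U(2), subst lcos_m_assoc) (auto simp: lcos_mult_one)
  then show "inv g <# A \<in> \<U>" using U by simp
next
  assume "inv g <# A \<in> \<U>"
  moreover have "A = g <# (inv g <# A)"
    using A g by (simp add: lcos_m_assoc lcos_mult_one)
  ultimately show "A \<in> translate_family G g \<U>" by (auto simp: translate_family_def)
qed

lemma mem_l_coset_iff:
  assumes "A \<subseteq> carrier G" "g \<in> carrier G" "x \<in> carrier G"
  shows "x \<in> g <# A \<longleftrightarrow> inv g \<otimes> x \<in> A"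
proof
  assume "x \<in> g <# A"
  then obtain a where "a \<in> A" "x = g \<otimes> a" by (auto simp: l_coset_def)
  then show "inv g \<otimes> x \<in> A" using assms by (auto simp: m_assoc[symmetric])
next
  assume "inv g \<otimes> x \<in> A"
  moreover have "x = g \<otimes> (inv g \<otimes> x)" using assms by (simp add: m_assoc[symmetric])
  ultimately show "x \<in> g <# A" unfolding l_coset_def by blast
qed

lemma induced_ball_eq:
  "induced_ball G A y F = {z \<in> A. z = y \<or> (\<exists>f\<in>F. z = f \<otimes> y)}"
  by (auto simp: induced_ball_def group_ball_def r_coset_def)

lemma bounded_subset_finite: "bounded_subset G A Y \<Longrightarrow> finite Y"
proof -
  have "finite (induced_ball G A a F)" if "radius G F" for a F
  proof -
    have "induced_ball G A a F \<subseteq> insert a ((\<lambda>f. f \<otimes> a) ` F)" by (auto simp: induced_ball_eq)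
    then show ?thesis using that by (auto simp: radius_def intro: finite_subset)
  qed
  then show "bounded_subset G A Y \<Longrightarrow> finite Y"
    by (auto simp: bounded_subset_def intro: finite_subset)
qed

text \<open>Any \<open>a \<in> Y\<close> serves as centre, with the quotients
  \<open>z \<otimes> inv a\<close> as radius. Together with \<open>bounded_subset_finite\<close>
  this makes unbounded subsets of \<open>A\<close> the infinite ones.\<close>

lemma finite_bounded_subset:
  assumes "A \<subseteq> carrier G" "Y \<subseteq> A" "finite Y"
  shows "bounded_subset G A Y"
proof (cases "Y = {}")
  case False
  then obtain a where a: "a \<in> Y" by blast
  have "z \<in> induced_ball G A a ((\<lambda>z. z \<otimes> inv a) ` Y)" if "z \<in> Y" for z
  proof -
    have "z = (z \<otimes> inv a) \<otimes> a" using that a assms by (simp add: m_assoc subset_iff)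
    then show ?thesis using that assms(2) unfolding induced_ball_eq by blast
  qed
  moreover have "radius G ((\<lambda>z. z \<otimes> inv a) ` Y)"
    using a assms by (auto simp: radius_def)
  ultimately show ?thesis using a assms(2) unfolding bounded_subset_def by blast
qed (simp add: bounded_subset_def)

section \<open>The cycle of implications (i) to (ii) to (iii) to (i)\<close>

lemma asymptotically_scattered_imp_sparse_subset:
  assumes A: "A \<subseteq> carrier G" and scat: "asymptotically_scattered G A"
  shows "sparse_subset G A"
proof (rule ccontr)
  assume "\<not> sparse_subset G A"
  then obtain D where D: "D \<subseteq> carrier G" "infinite D"
    and inf: "\<And>F. finite F \<Longrightarrow> F \<subseteq> D \<Longrightarrow> infinite (carrier G \<inter> (\<Inter>g\<in>F. g <# A))"
    by (auto simp: sparse_subset_def)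
  obtain d :: "nat \<Rightarrow> 'a" where d: "inj d" "range d \<subseteq> D"
    using infinite_countable_subset[OF D(2)] by blast
  then have dG: "\<And>i. d i \<in> carrier G" using D by blast
  have "infinite (carrier G \<inter> (\<Inter>g\<in>d ` {..n}. g <# A))" for n
    using d by (intro inf) auto
  from inj_choice_infinite[OF this]
  obtain x where x: "inj x" "\<And>n. x n \<in> carrier G" "\<And>n i. i \<le> n \<Longrightarrow> x n \<in> d i <# A"
    by fastforce
  define y where "y n = inv (d 0) \<otimes> x n" for n
  \<comment> \<open>The factor \<open>d 0\<close> cancels the one in \<open>y n\<close>, so that
    \<open>e i \<otimes> y n = inv (d i) \<otimes> x n\<close>.\<close>
  define e where "e i = inv (d i) \<otimes> d 0" for i
  have eG: "e i \<in> carrier G" for i using dG by (simp add: e_def)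
  have yA: "y n \<in> A" for n
    using mem_l_coset_iff[OF A dG x(2)] x(3)[of 0 n] by (simp add: y_def)
  have yG: "y n \<in> carrier G" for n using yA A by blast
  have ey: "e i \<otimes> y n \<in> A" if "i \<le> n" for i n
  proof -
    have "e i \<otimes> y n = inv (d i) \<otimes> (d 0 \<otimes> (inv (d 0) \<otimes> x n))"
      unfolding e_def y_def using dG x(2) by (simp add: m_assoc)
    also have "\<dots> = inv (d i) \<otimes> x n"
      using dG x(2) by (simp add: m_assoc[symmetric])
    finally show ?thesis using mem_l_coset_iff[OF A dG x(2)] x(3)[OF that] by simp
  qed
  have "inj y" using x(1,2) dG by (auto simp: inj_def y_def)
  then have "infinite (range y)" by (simp add: finite_image_iff)
  have "inj e"
  proof (rule injI)
    fix i j assume "e i = e j"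
    then have "inv (d i) = inv (d j)" using dG by (simp add: e_def)
    then have "d i = d j" by (metis dG inv_inv)
    then show "i = j" using d(1) by (simp add: inj_eq)
  qed
  have "range y \<subseteq> A" using yA by blast
  then have "infinite A" using \<open>infinite (range y)\<close> finite_subset by blast
  have "has_asymptotically_isolated_balls G A (range y)"
    using scat \<open>range y \<subseteq> A\<close> \<open>infinite (range y)\<close> bounded_subset_finite
    unfolding asymptotically_scattered_def by blast
  then obtain F where F: "radius G F"
    and iso: "\<And>H. radius G H \<Longrightarrow> radius_less G A F H \<Longrightarrow>
      \<exists>n. induced_ball G A (y n) H \<subseteq> induced_ball G A (y n) F"
    by (auto simp: has_asymptotically_isolated_balls_def)
  have finF: "finite F" and FG: "F \<subseteq> carrier G" using F by (auto simp: radius_def)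
  \<comment> \<open>Besides \<open>F\<close>, the unit has to be avoided, since every ball contains
    its centre.\<close>
  have "infinite (range e - insert \<one> F)"
    using \<open>inj e\<close> finF by (simp add: finite_image_iff)
  then obtain i where i: "e i \<noteq> \<one>" "e i \<notin> F"
    using infinite_imp_nonempty by blast
  have "\<exists>a. a \<in> A - induced_ball G A (y n) F" for n
  proof -
    have "bounded_subset G A (induced_ball G A (y n) F)"
      using yA F unfolding bounded_subset_def by blast
    then have "infinite (A - induced_ball G A (y n) F)"
      using \<open>infinite A\<close> by (intro Diff_infinite_finite bounded_subset_finite)
    then have "A - induced_ball G A (y n) F \<noteq> {}" by (rule infinite_imp_nonempty)
    then show ?thesis by blast
  qed
  then obtain a where a: "\<And>n. a n \<in> A" "\<And>n. a n \<notin> induced_ball G A (y n) F"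
    by (metis DiffD1 DiffD2)
  have aG: "a n \<in> carrier G" for n using a(1) A by blast
  \<comment> \<open>The element \<open>e i\<close> enlarges the ball around \<open>y n\<close> for
    all \<open>n \<ge> i\<close>. For each of the finitely many \<open>n < i\<close> the last part
    carries \<open>y n\<close> to the point \<open>a n\<close> of \<open>A\<close> outside its
    \<open>F\<close>-ball.\<close>
  define H where "H = F \<union> {e i} \<union> (\<lambda>n. a n \<otimes> inv (y n)) ` {..<i}"
  have "radius G H"
    using finF FG aG eG yG by (auto simp: radius_def H_def)
  moreover have "radius_less G A F H"
    by (auto simp: radius_less_def H_def induced_ball_eq)
  ultimately obtain n where n: "induced_ball G A (y n) H \<subseteq> induced_ball G A (y n) F"
    using iso by blast
  show False
  proof (cases "i \<le> n")
    case True
    then have "e i \<otimes> y n \<in> induced_ball G A (y n) H"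
      using ey by (auto simp: induced_ball_eq H_def)
    then have "e i \<otimes> y n = y n \<or> (\<exists>f\<in>F. e i \<otimes> y n = f \<otimes> y n)"
      using n by (auto simp: induced_ball_eq)
    then consider "e i = \<one>" | f where "f \<in> F" "e i = f"
      using eG[of i] yG[of n] FG by (metis right_cancel r_cancel_one subsetD)
    then show False using i by cases auto
  next
    case False
    have "a n = (a n \<otimes> inv (y n)) \<otimes> y n"
      using aG yG by (simp add: m_assoc)
    moreover have "a n \<otimes> inv (y n) \<in> H" using False by (simp add: H_def)
    ultimately have "a n \<in> induced_ball G A (y n) H"
      using a(1) unfolding induced_ball_eq by blast
    then show False using a(2) n by blast
  qed
qed

text \<open>Were the set infinite, sparseness would yield a finite intersection of finitely many
  members of \<open>\<U>\<close>; it would belong to \<open>\<U>\<close>, whose members are all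
  infinite.\<close>

lemma sparse_subset_imp_finite_translates:
  assumes A: "A \<subseteq> carrier G" and sparse: "sparse_subset G A"
    and free: "free_ultrafilter_on (carrier G) \<U>"
  shows "finite {g \<in> carrier G. A \<in> translate_family G g \<U>}" (is "finite ?D")
proof (rule ccontr)
  assume "infinite ?D"
  have uf: "ultrafilter_on (carrier G) \<U>" using free by (simp add: free_ultrafilter_on_def)
  then have \<U>: "\<U> \<subseteq> Pow (carrier G)" by (simp add: ultrafilter_on_def)
  \<comment> \<open>Sparseness is applied to the inverses, because
    \<open>A \<in> translate_family G g \<U>\<close> means
    \<open>inv g <# A \<in> \<U>\<close>.\<close>
  have "inj_on (\<lambda>g. inv g) ?D" by (auto intro: inj_onI dest: inv_inj[THEN inj_onD])
  then have "infinite ((\<lambda>g. inv g) ` ?D)" using \<open>infinite ?D\<close> by (simp add: finite_image_iff)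
  moreover have "(\<lambda>g. inv g) ` ?D \<subseteq> carrier G" by auto
  ultimately have "\<exists>F. finite F \<and> F \<subseteq> (\<lambda>g. inv g) ` ?D \<and> finite (carrier G \<inter> (\<Inter>g\<in>F. g <# A))"
    using sparse[unfolded sparse_subset_def, rule_format, of "(\<lambda>g. inv g) ` ?D"] by simp
  then obtain F where F: "finite F" "F \<subseteq> (\<lambda>g. inv g) ` ?D"
    and fin: "finite (carrier G \<inter> (\<Inter>g\<in>F. g <# A))"
    by (elim exE conjE)
  have "(\<lambda>g. g <# A) ` F \<subseteq> \<U>"
    using F(2) translate_family_iff[OF A \<U>] by auto
  then have "carrier G \<inter> (\<Inter>g\<in>F. g <# A) \<in> \<U>"
    using F(1) by (intro ultrafilter_on_finite_Inter[OF uf]) auto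
  from free_ultrafilter_on_infinite[OF free this] fin show False by contradiction
qed

lemma finite_translates_imp_asymptotically_scattered:
  assumes A: "A \<subseteq> carrier G"
    and fin: "\<And>\<U>. free_ultrafilter_on (carrier G) \<U> \<Longrightarrow> A \<in> \<U> \<Longrightarrow>
      finite {g \<in> carrier G. A \<in> translate_family G g \<U>}"
  shows "asymptotically_scattered G A"
  unfolding asymptotically_scattered_def
proof (intro allI impI, elim conjE)
  fix Y assume Y: "Y \<subseteq> A" "\<not> bounded_subset G A Y"
  then have "infinite Y" using finite_bounded_subset[OF A] by blast
  then obtain \<U> where free: "free_ultrafilter_on (carrier G) \<U>" and YU: "Y \<in> \<U>"
    using free_ultrafilter_on_exists[of Y "carrier G"] Y A by blast
  have uf: "ultrafilter_on (carrier G) \<U>" using free by (simp add: free_ultrafilter_on_def)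
  then have \<U>: "\<U> \<subseteq> Pow (carrier G)"
    and up: "\<And>U V. U \<in> \<U> \<Longrightarrow> U \<subseteq> V \<Longrightarrow> V \<subseteq> carrier G \<Longrightarrow> V \<in> \<U>"
    unfolding ultrafilter_on_def by blast+
  \<comment> \<open>This radius depends only on \<open>\<U>\<close>, not on \<open>H\<close>;
    hypothesis (iii) makes it finite.\<close>
  define F where "F = {g \<in> carrier G. A \<in> translate_family G g \<U>}"
  have F: "radius G F"
    using fin[OF free] up[OF YU Y(1) A] by (auto simp: radius_def F_def)
  show "has_asymptotically_isolated_balls G A Y"
    unfolding has_asymptotically_isolated_balls_def
  proof (intro exI[of _ F] conjI F allI impI; elim conjE; rule ccontr)
    fix H assume H: "radius G H"
    assume "\<not> (\<exists>y\<in>Y. induced_ball G A y H - induced_ball G A y F = {})"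
    then have ball: "\<exists>z. z \<in> induced_ball G A y H - induced_ball G A y F" if "y \<in> Y" for y
      using that by blast
    have HG: "H \<subseteq> carrier G" and "finite H" using H by (auto simp: radius_def)
    \<comment> \<open>A point of the \<open>H\<close>-ball around \<open>y\<close> outside the
      \<open>F\<close>-ball differs from \<open>y\<close>, hence is \<open>h \<otimes> y\<close>
      with \<open>h \<in> H - F\<close>.\<close>
    have "Y \<subseteq> (\<Union>h\<in>H - F. inv h <# A)"
    proof
      fix y assume y: "y \<in> Y"
      then obtain h where h: "h \<in> H - F" "h \<otimes> y \<in> A"
        using ball[OF y] by (auto simp: induced_ball_eq)
      moreover have "h \<in> carrier G" "y \<in> carrier G" using h(1) HG y Y(1) A by auto
      ultimately have "y \<in> inv h <# A" using mem_l_coset_iff[OF A, of "inv h" y] by simp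
      then show "y \<in> (\<Union>h\<in>H - F. inv h <# A)" using h(1) by blast
    qed
    moreover have sub: "inv h <# A \<subseteq> carrier G" if "h \<in> H - F" for h
      using that HG A by (intro l_coset_subset_G) auto
    ultimately have "(\<Union>h\<in>H - F. inv h <# A) \<in> \<U>" by (intro up[OF YU]) auto
    then obtain h where "h \<in> H - F" "inv h <# A \<in> \<U>"
      using ultrafilter_on_finite_UN[OF uf, of "H - F" "\<lambda>h. inv h <# A"] \<open>finite H\<close> sub by auto
    \<comment> \<open>By the choice of \<open>F\<close>, membership of \<open>inv h <# A\<close> in
      \<open>\<U>\<close> forces \<open>h \<in> F\<close>.\<close>
    then show False
      using translate_family_iff[OF A \<U>] HG by (auto simp: F_def)
  qed
qed

end

theorem theorem10:
  fixes G :: "('a, 'b) monoid_scheme" and A :: "'a set"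
  assumes "group G" and "countable (carrier G)" and "A \<subseteq> carrier G"
  shows "(asymptotically_scattered G A \<longleftrightarrow> sparse_subset G A) \<and>
         (sparse_subset G A \<longleftrightarrow>
           (\<forall>\<U>. free_ultrafilter_on (carrier G) \<U> \<and> A \<in> \<U> \<longrightarrow>
             finite {g \<in> carrier G. A \<in> translate_family G g \<U>}))"
proof -
  interpret group G by fact
  show ?thesis
    using asymptotically_scattered_imp_sparse_subset[OF assms(3)]
      sparse_subset_imp_finite_translates[OF assms(3)]
      finite_translates_imp_asymptotically_scattered[OF assms(3)]
    by blast
qed

end
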